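(* Let $n\ge1$ be an integer and $q\in\mathbb{C}$, $0<|q|<1$. Then $$2(-1)^{\binom n2}q^{-n(n-1)(2n-1)/6}\,\theta(q;q^3)^n\prod_{1\le i<j\le n}\frac{(q^{j-i})_\infty}{(q^{j-i+1})_\infty}=\det_{1\le i,j\le n}\left(q^{(n-i)(j-1)}\theta(q^{2n-2i+j};q^3)+q^{-(n-i)(j-1)}\theta(q^{2n-2i-j+2};q^3)\right).$$
   Context: $(a;q)_\infty=\prod_{i\ge0}(1-aq^i)$, $(a)_\infty=(a;q)_\infty$, $\theta(z;q)=(z;q)_\infty(q/z;q)_\infty$. *)

theory Defs
  imports
    "HOL-Analysis.Infinite_Products"
    "Jordan_Normal_Form.Determinant"
begin

definition qpoch_inf :: "complex \<Rightarrow> complex \<Rightarrow> complex" where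
  "qpoch_inf a q = (\<Prod>i. 1 - a * q ^ i)"

definition qtheta :: "complex \<Rightarrow> complex \<Rightarrow> complex" where
  "qtheta z q = qpoch_inf z q * qpoch_inf (q / z) q"

(* Rows and columns of Matrix.mat are numbered from 0, so the 1-based indices are i = r + 1
   and j = s + 1. They are integers because the exponent 2n - 2i - j + 2 can be negative. *)
definition theta_matrix :: "nat \<Rightarrow> complex \<Rightarrow> complex mat" where
  "theta_matrix n q = mat n n (\<lambda>(r, s).
     let N = int n; i = int r + 1; j = int s + 1 in
       q powi ((N - i) * (j - 1)) * qtheta (q powi (2 * N - 2 * i + j)) (q ^ 3) +
       q powi (- ((N - i) * (j - 1))) * qtheta (q powi (2 * N - 2 * i - j + 2)) (q ^ 3))"

end

theory Submission
  imports Defs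
begin

text \<open>
  The nome \<open>q\<^sup>3\<close> and the integer exponents make every entry of the matrix a monomial multiple of
  \<open>\<theta>(q;q\<^sup>3)\<close>. Put \<open>\<zeta> k = \<theta>(q\<^bsup>k+1\<^esup>;q\<^sup>3)\<close>, let \<open>L\<close> be the linear functional
  \<open>u\<^bsup>k\<^esup> \<mapsto> \<zeta> k\<close> on Laurent polynomials (by the triple product it is proportional to the sum of
  \<open>f(q\<^bsup>N\<^esup>)\<close> over the pentagonal weights \<open>(-1)\<^bsup>N\<^esup>q\<^bsup>N(3N-1)/2\<^esup>\<close>), and let
  \<open>y = u + u\<^bsup>-1\<^esup>\<close>. Quasi-periodicity turns the entry with \<open>m = n - i\<close> and \<open>s = j - 1\<close> into a
  monomial times \<open>L(u\<^bsup>-m\<^esup>(u\<^bsup>s\<^esup> + u\<^bsup>-s\<^esup>))\<close>, so the determinant is a Hankel determinant of \<open>L\<close> in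
  the variable \<open>y\<close>. With \<open>p = 1/q\<close>, the functional \<open>L\<close> takes the same value \<open>\<theta>(q;q\<^sup>3)\<close> on all the
  products \<open>\<phi>\<^sub>s = \<Prod>i<s. (1 - p\<^bsup>i\<^esup>u)(1 - p\<^bsup>i\<^esup>/u)\<close>; hence its orthogonal polynomials are continuous
  big \<open>q\<close>-Hermite polynomials in base \<open>p\<close>, whose norms \<open>(p;p)\<^sub>k\<close> give the product formula.
\<close>

section \<open>Infinite products and theta functions\<close>

lemma convergent_prod_qpoch:
  fixes a q :: complex
  assumes "norm q < 1"
  shows "convergent_prod (\<lambda>i. 1 - a * q ^ i)"
proof -
  have "summable (\<lambda>i. norm a * norm q ^ i)"
    using assms by (intro summable_mult summable_geometric) simp
  then have "abs_convergent_prod (\<lambda>i. 1 - a * q ^ i)"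
    unfolding abs_convergent_prod_conv_summable by (simp add: norm_mult norm_power)
  then show ?thesis
    by (rule abs_convergent_prod_imp_convergent_prod)
qed

lemma qpoch_inf_rec:
  assumes "norm q < 1"
  shows "qpoch_inf a q = (1 - a) * qpoch_inf (a * q) q"
proof -
  have "(\<lambda>i. 1 - a * q ^ Suc i) has_prod qpoch_inf (a * q) q"
    using convergent_prod_has_prod[OF convergent_prod_qpoch[OF assms, of "a * q"]]
    by (simp add: qpoch_inf_def mult.assoc)
  then have "(\<lambda>i. 1 - a * q ^ i) has_prod (qpoch_inf (a * q) q * (1 - a * q ^ 0))"
    by (rule has_prod_Suc_imp)
  then show ?thesis
    using has_prod_unique by (fastforce simp: qpoch_inf_def mult.commute)
qed

lemma qpoch_inf_nonzero:
  assumes "norm q < 1" "norm a < 1"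
  shows "qpoch_inf a q \<noteq> 0"
  unfolding qpoch_inf_def
proof (rule prodinf_nonzero[OF convergent_prod_qpoch[OF assms(1)]])
  fix i
  have "norm (a * q ^ i) \<le> norm a"
    using assms by (simp add: norm_mult norm_power mult_left_le power_le_one)
  then show "1 - a * q ^ i \<noteq> 0"
    using assms by auto
qed

lemma qpoch_inf_ratio:
  assumes "norm q < 1" "norm a < 1"
  shows "qpoch_inf a q / qpoch_inf (a * q) q = 1 - a"
proof -
  have "norm (a * q) < 1"
    using assms by (metis mult_less_cancel_right2 norm_ge_zero norm_mult order_le_less_trans
        mult_left_le order_less_imp_le)
  then show ?thesis
    using qpoch_inf_nonzero[OF assms(1)] qpoch_inf_rec[OF assms(1), of a] by auto
qed

lemma qtheta_symm:
  assumes "p \<noteq> 0" "z \<noteq> 0"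
  shows "qtheta (p / z) p = qtheta z p"
  using assms by (simp add: qtheta_def)

lemma qtheta_quasi_periodic:
  assumes "norm p < 1" "p \<noteq> 0" "z \<noteq> 0"
  shows "qtheta (z * p) p = - qtheta z p / z"
proof -
  have "qtheta (z * p) p = qpoch_inf (z * p) p * ((1 - 1 / z) * qpoch_inf (p / z) p)"
    using assms qpoch_inf_rec[OF assms(1), of "1 / z"] by (simp add: qtheta_def)
  also have "\<dots> = - ((1 - z) * qpoch_inf (z * p) p * qpoch_inf (p / z) p) / z"
    using assms by (simp add: field_simps)
  also have "(1 - z) * qpoch_inf (z * p) p = qpoch_inf z p"
    using qpoch_inf_rec[OF assms(1), of z] by simp
  finally show ?thesis
    by (simp add: qtheta_def)
qed

lemma qtheta_self:
  assumes "norm p < 1" "p \<noteq> 0"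
  shows "qtheta p p = 0"
  using assms qpoch_inf_rec[OF assms(1), of 1] by (simp add: qtheta_def)

section \<open>Linear functionals on Laurent polynomials\<close>

text \<open>The value on \<open>u^k (u + 1/u)^i\<close> of the functional sending \<open>u^j\<close>
  to \<open>z j\<close>.\<close>

fun moment :: "(int \<Rightarrow> complex) \<Rightarrow> nat \<Rightarrow> int \<Rightarrow> complex" where
  "moment z 0 k = z k"
| "moment z (Suc i) k = moment z i (k + 1) + moment z i (k - 1)"

text \<open>
  \<open>act z F k\<close> is the value on \<open>u\<^bsup>k\<^esup> F(u + 1/u)\<close> of the functional sending \<open>u\<^bsup>j\<^esup>\<close> to \<open>z j\<close>.
\<close>
definition act :: "(int \<Rightarrow> complex) \<Rightarrow> complex poly \<Rightarrow> int \<Rightarrow> complex" where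
  "act z F k = (\<Sum>i\<le>degree F. coeff F i * moment z i k)"

lemma act_bound:
  assumes "\<And>i. i > N \<Longrightarrow> coeff F i = 0"
  shows "act z F k = (\<Sum>i\<le>N. coeff F i * moment z i k)"
proof -
  have "degree F \<le> N"
    using assms by (intro degree_le) auto
  then show ?thesis
    unfolding act_def by (intro sum.mono_neutral_left) (auto simp: coeff_eq_0)
qed

lemma act_add: "act z (F + G) k = act z F k + act z G k"
proof -
  define N where "N = max (degree F) (degree G)"
  have "act z H k = (\<Sum>i\<le>N. coeff H i * moment z i k)" if "H \<in> {F, G, F + G}" for H
    using that by (intro act_bound) (auto simp: N_def coeff_eq_0)
  then show ?thesis
    by (simp add: sum.distrib distrib_right)
qed

lemma act_smult: "act z (smult c F) k = c * act z F k"
proof -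
  have "act z (smult c F) k = (\<Sum>i\<le>degree F. coeff (smult c F) i * moment z i k)"
    by (intro act_bound) (auto simp: coeff_eq_0)
  then show ?thesis
    by (simp add: act_def sum_distrib_left mult.assoc)
qed

lemma act_diff: "act z (F - G) k = act z F k - act z G k"
  using act_add[of z F "smult (-1) G" k] act_smult[of z "-1" G k] by simp

lemma act_sum: "act z (\<Sum>i\<in>A. F i) k = (\<Sum>i\<in>A. act z (F i) k)"
  by (induction A rule: infinite_finite_induct) (simp_all add: act_add, simp_all add: act_def)

lemma act_1 [simp]: "act z 1 k = z k"
  by (simp add: act_def)

lemma act_pCons_0: "act z (pCons 0 F) k = act z F (k + 1) + act z F (k - 1)"
proof -
  have "act z (pCons 0 F) k = (\<Sum>i\<le>Suc (degree F). coeff (pCons 0 F) i * moment z i k)"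
    by (intro act_bound) (auto simp: coeff_pCons coeff_eq_0 split: nat.splits)
  also have "\<dots> = (\<Sum>i\<le>degree F. coeff F i * moment z (Suc i) k)"
    by (subst sum.atMost_Suc_shift) (simp add: coeff_pCons)
  finally show ?thesis
    by (simp add: act_def sum.distrib algebra_simps)
qed

text \<open>Since \<open>u + 1/u\<close> is invariant under \<open>u -> 1/u\<close>, the symmetry of
  \<open>z\<close> about 1/2 survives the factor \<open>F\<close>.\<close>

lemma act_reflect:
  assumes "\<And>k. z (1 - k) = z k"
  shows "act z F (1 - k) = act z F k"
proof -
  have "moment z i (1 - k) = moment z i k" for i
  proof (induction i arbitrary: k)
    case (Suc i)
    show ?case
      using Suc[of "k + 1"] Suc[of "k - 1"] by (simp add: algebra_simps)
  qed (simp add: assms)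
  then show ?thesis
    by (simp add: act_def)
qed

text \<open>
  The two families of Chebyshev polynomials: \<open>u\<^bsup>s\<^esup> + u\<^bsup>-s\<^esup>\<close> and
  \<open>(u\<^bsup>m+1/2\<^esup> + u\<^bsup>-m-1/2\<^esup>) / (u\<^bsup>1/2\<^esup> + u\<^bsup>-1/2\<^esup>)\<close> in the variable \<open>u + 1/u\<close>.
\<close>
fun cheb_T :: "nat \<Rightarrow> complex poly" where
  "cheb_T 0 = [:2:]"
| "cheb_T (Suc 0) = [:0, 1:]"
| "cheb_T (Suc (Suc s)) = pCons 0 (cheb_T (Suc s)) - cheb_T s"

fun cheb_V :: "nat \<Rightarrow> complex poly" where
  "cheb_V 0 = 1"
| "cheb_V (Suc 0) = [:-1, 1:]"
| "cheb_V (Suc (Suc m)) = pCons 0 (cheb_V (Suc m)) - cheb_V m"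

lemma act_cheb_T: "act z (cheb_T s) k = z (k + int s) + z (k - int s)"
proof (induction s arbitrary: k rule: cheb_T.induct)
  case 1
  show ?case by (simp add: act_def)
next
  case 2
  show ?case by (simp add: act_def)
next
  case (3 s)
  show ?case
    by (simp add: act_diff act_pCons_0 3 algebra_simps)
qed

text \<open>
  For a functional invariant under \<open>u\<^bsup>k\<^esup> \<mapsto> u\<^bsup>1-k\<^esup>\<close>, the factor \<open>u\<^bsup>-m\<^esup>\<close> may be replaced by its
  symmetrization, which is a polynomial of degree \<open>m\<close> in \<open>u + 1/u\<close>.
\<close>
lemma act_cheb_V:
  assumes "\<And>k. z (1 - k) = z k"
  shows "act z (cheb_V m * F) 0 = act z F (- int m)"
proof (induction m arbitrary: F rule: cheb_V.induct)
  case 1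
  show ?case by simp
next
  case 2
  have "[:-1, 1:] * F = pCons 0 F - F" by simp
  \<comment> \<open>Reflection turns the value at 1 into the value at 0, which the constant -1
    cancels; the value at -1 remains.\<close>
  then show ?case
    using act_reflect[where z = z, OF assms, of F 0] by (simp add: act_diff act_pCons_0)
next
  case (3 m)
  have "cheb_V (Suc (Suc m)) * F = cheb_V (Suc m) * pCons 0 F - cheb_V m * F"
    by (simp add: left_diff_distrib)
  then have "act z (cheb_V (Suc (Suc m)) * F) 0 =
      act z (cheb_V (Suc m) * pCons 0 F) 0 - act z (cheb_V m * F) 0"
    by (simp only: act_diff)
  also have "\<dots> = act z F (- int (Suc (Suc m)))"
    unfolding 3 act_pCons_0 by (simp add: algebra_simps)
  finally show ?case .
qed

section \<open>Gram determinants\<close>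

lemma det_triangular_mult:
  fixes A B C :: "'a :: comm_ring_1 mat"
  assumes A: "A \<in> carrier_mat n n" "\<And>i j. i < j \<Longrightarrow> j < n \<Longrightarrow> A $$ (i, j) = 0"
    and B: "B \<in> carrier_mat n n"
    and C: "C \<in> carrier_mat n n" "\<And>i j. i < j \<Longrightarrow> j < n \<Longrightarrow> C $$ (i, j) = 0"
  shows "det (A * B * transpose_mat C) = (\<Prod>i<n. A $$ (i, i)) * det B * (\<Prod>i<n. C $$ (i, i))"
proof -
  have "det (A * B * transpose_mat C) = det A * det B * det C"
    using A(1) B C(1) by (simp add: det_mult[of _ n] det_transpose[of _ n])
  moreover have "det D = (\<Prod>i<n. D $$ (i, i))"
    if "D \<in> carrier_mat n n" "\<And>i j. i < j \<Longrightarrow> j < n \<Longrightarrow> D $$ (i, j) = 0" for D :: "'a mat"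
    using det_lower_triangular[OF that(2,1)] that(1)
    by (simp add: prod_list_diag_prod atLeast0LessThan)
  ultimately show ?thesis
    using A C by simp
qed

lemma act_mult:
  assumes "\<And>i. i > M \<Longrightarrow> coeff F i = 0" "\<And>i. i > N \<Longrightarrow> coeff G i = 0"
  shows "act z (F * G) k = (\<Sum>i\<le>M. \<Sum>j\<le>N. coeff F i * coeff G j * moment z (i + j) k)"
proof -
  have mono: "(\<Sum>i\<le>n. monom (coeff H i) i) = H"
    if "\<And>i. i > n \<Longrightarrow> coeff H i = 0" for n and H :: "complex poly"
    by (rule poly_as_sum_of_monoms') (use that in \<open>auto intro!: degree_le\<close>)
  have act_monom: "act z (monom c i) k = c * moment z i k" for c i
  proof -
    have "act z (monom c i) k = (\<Sum>j\<le>i. coeff (monom c i) j * moment z j k)"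
      by (intro act_bound) auto
    also have "\<dots> = (\<Sum>j\<in>{i}. coeff (monom c i) j * moment z j k)"
      by (intro sum.mono_neutral_right) auto
    finally show ?thesis by simp
  qed
  have "F * G = (\<Sum>i\<le>M. \<Sum>j\<le>N. monom (coeff F i * coeff G j) (i + j))"
    by (subst mono[OF assms(1), symmetric], assumption, subst mono[OF assms(2), symmetric],
        assumption) (simp add: sum_product mult_monom)
  then show ?thesis
    by (simp add: act_sum act_monom)
qed

text \<open>The matrix factors as triangular times Hankel times triangular, so only the top
  coefficients of the two families enter. One pair of families evaluates the Hankel determinant,
  another carries it to the theta matrix.\<close>

lemma det_gram:
  assumes a: "\<And>m i. i > m \<Longrightarrow> coeff (a m) i = 0" and b: "\<And>m i. i > m \<Longrightarrow> coeff (b m) i = 0"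
  shows "det (mat n n (\<lambda>(m, s). act z (a m * b s) k)) =
    (\<Prod>m<n. coeff (a m) m) * det (mat n n (\<lambda>(i, j). moment z (i + j) k)) * (\<Prod>s<n. coeff (b s) s)"
proof -
  let ?A = "mat n n (\<lambda>(m, i). coeff (a m) i)" and ?B = "mat n n (\<lambda>(m, i). coeff (b m) i)"
  let ?H = "mat n n (\<lambda>(i, j). moment z (i + j) k)"
  have "mat n n (\<lambda>(m, s). act z (a m * b s) k) = ?A * ?H * transpose_mat ?B"
  proof (rule eq_matI)
    fix m s
    assume "m < dim_row (?A * ?H * transpose_mat ?B)" "s < dim_col (?A * ?H * transpose_mat ?B)"
    then have m: "m < n" and s: "s < n" by auto
    have "act z (a m * b s) k =
        (\<Sum>i\<le>n - 1. \<Sum>j\<le>n - 1. coeff (a m) i * coeff (b s) j * moment z (i + j) k)"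
      by (rule act_mult) (use m s a b in auto)
    also have "{..n - 1} = {0..<n}"
      using m by auto
    also have "(\<Sum>i=0..<n. \<Sum>j=0..<n. coeff (a m) i * coeff (b s) j * moment z (i + j) k) =
        (\<Sum>j=0..<n. (\<Sum>i=0..<n. coeff (a m) i * moment z (i + j) k) * coeff (b s) j)"
      by (subst sum.swap) (simp add: sum_distrib_left sum_distrib_right mult_ac)
    finally show "mat n n (\<lambda>(m, s). act z (a m * b s) k) $$ (m, s) =
        (?A * ?H * transpose_mat ?B) $$ (m, s)"
      using m s by (simp add: scalar_prod_def)
  qed auto
  also have "det \<dots> = (\<Prod>i<n. ?A $$ (i, i)) * det ?H * (\<Prod>i<n. ?B $$ (i, i))"
    by (rule det_triangular_mult) (auto simp: a b)
  finally show ?thesis by simp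
qed

text \<open>Reversal is multiplication by the antidiagonal \<open>J n\<close>, whose determinant
  comes from expansion along the first row.\<close>

lemma det_rev_rows:
  fixes f :: "nat \<Rightarrow> nat \<Rightarrow> 'a :: comm_ring_1"
  shows "det (mat n n (\<lambda>(i, j). f (n - 1 - i) j)) = (\<Prod>k<n. (-1) ^ k) * det (mat n n (\<lambda>(i, j). f i j))"
proof -
  define J :: "nat \<Rightarrow> 'a mat" where "J n = mat n n (\<lambda>(i, j). if i + j + 1 = n then 1 else 0)" for n
  have J: "J n \<in> carrier_mat n n" for n
    by (simp add: J_def)
  have detJ: "det (J n) = (\<Prod>k<n. (-1) ^ k)" for n
  proof (induction n)
    case 0
    show ?case by (simp add: J_def)
  next
    case (Suc n)
    have "mat_delete (J (Suc n)) 0 n = J n"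
      by (rule eq_matI) (auto simp: J_def mat_delete_def)
    then have "cofactor (J (Suc n)) 0 n = (-1) ^ n * det (J n)"
      by (simp add: cofactor_def)
    moreover have "det (J (Suc n)) = (\<Sum>j<Suc n. J (Suc n) $$ (0, j) * cofactor (J (Suc n)) 0 j)"
      by (rule laplace_expansion_row[OF J]) simp
    moreover have "\<dots> = (\<Sum>j\<in>{n}. J (Suc n) $$ (0, j) * cofactor (J (Suc n)) 0 j)"
      by (rule sum.mono_neutral_right) (auto simp: J_def)
    moreover have "J (Suc n) $$ (0, n) = 1"
      by (simp add: J_def)
    ultimately show ?case
      using Suc by simp
  qed
  have "mat n n (\<lambda>(i, j). f (n - 1 - i) j) = J n * mat n n (\<lambda>(i, j). f i j)"
  proof (rule eq_matI)
    fix i j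
    assume "i < dim_row (J n * mat n n (\<lambda>(i, j). f i j))" "j < dim_col (J n * mat n n (\<lambda>(i, j). f i j))"
    then have ij: "i < n" "j < n" by (auto simp: J_def)
    have "(J n * mat n n (\<lambda>(i, j). f i j)) $$ (i, j) =
        (\<Sum>k=0..<n. (if i + k + 1 = n then 1 else 0) * f k j)"
      using ij by (simp add: J_def scalar_prod_def)
    also have "\<dots> = (\<Sum>k\<in>{n - 1 - i}. (if i + k + 1 = n then 1 else 0) * f k j)"
      using ij by (intro sum.mono_neutral_right) auto
    finally show "mat n n (\<lambda>(i, j). f (n - 1 - i) j) $$ (i, j) =
        (J n * mat n n (\<lambda>(i, j). f i j)) $$ (i, j)"
      using ij by simp
  qed (auto simp: J_def)
  then show ?thesis
    by (simp add: det_mult[OF J] detJ)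
qed

lemma det_scale_rows:
  fixes f :: "nat \<Rightarrow> nat \<Rightarrow> 'a :: comm_ring_1"
  shows "det (mat n n (\<lambda>(i, j). c i * f i j)) = (\<Prod>i<n. c i) * det (mat n n (\<lambda>(i, j). f i j))"
proof -
  let ?D = "mat n n (\<lambda>(i, j). if i = j then c i else 0)"
  have "mat n n (\<lambda>(i, j). c i * f i j) = ?D * mat n n (\<lambda>(i, j). f i j)"
  proof (rule eq_matI)
    fix i j
    assume "i < dim_row (?D * mat n n (\<lambda>(i, j). f i j))" "j < dim_col (?D * mat n n (\<lambda>(i, j). f i j))"
    then have ij: "i < n" "j < n" by auto
    have "(?D * mat n n (\<lambda>(i, j). f i j)) $$ (i, j) = (\<Sum>k=0..<n. (if i = k then c i else 0) * f k j)"
      using ij by (simp add: scalar_prod_def)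
    also have "\<dots> = (\<Sum>k\<in>{i}. (if i = k then c i else 0) * f k j)"
      using ij by (intro sum.mono_neutral_right) auto
    finally show "mat n n (\<lambda>(i, j). c i * f i j) $$ (i, j) = (?D * mat n n (\<lambda>(i, j). f i j)) $$ (i, j)"
      using ij by simp
  qed auto
  moreover have "det ?D = (\<Prod>i<n. c i)"
    using det_lower_triangular[of n ?D] by (simp add: prod_list_diag_prod atLeast0LessThan)
  ultimately show ?thesis
    by (simp add: det_mult[of _ n])
qed

section \<open>The Hankel determinant\<close>

text \<open>With \<open>y = u + 1/u\<close> this is \<open>(1 - c u)(1 - c/u)\<close>.\<close>

definition phi_factor :: "complex \<Rightarrow> complex poly" where
  "phi_factor c = [:1 + c\<^sup>2, - c:]"

definition phi :: "complex \<Rightarrow> nat \<Rightarrow> complex poly" where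
  "phi p s = (\<Prod>i<s. phi_factor (p ^ i))"

text \<open>Monic continuous big q-Hermite polynomials in base \<open>p\<close> with parameter 1,
  where \<open>y\<close> is twice the usual variable.\<close>

fun big_q_hermite :: "complex \<Rightarrow> nat \<Rightarrow> complex poly" where
  "big_q_hermite p 0 = 1"
| "big_q_hermite p (Suc 0) = [:-1, 1:]"
| "big_q_hermite p (Suc (Suc k)) =
     [:- (p ^ Suc k), 1:] * big_q_hermite p (Suc k) - smult (1 - p ^ Suc k) (big_q_hermite p k)"

text \<open>Serves three recurrences at once; the top coefficient at \<open>m = 0\<close> stays open
  because \<open>cheb_T\<close> starts with the constant 2.\<close>

lemma monic_rec_coeff:
  fixes P :: "nat \<Rightarrow> complex poly"
  assumes P1: "P (Suc 0) = [:c, 1:]" and P0: "\<And>i. i > 0 \<Longrightarrow> coeff (P 0) i = 0"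
    and rec: "\<And>k. P (Suc (Suc k)) = pCons 0 (P (Suc k)) + smult (b k) (P (Suc k)) - smult (d k) (P k)"
  shows "(\<forall>i>m. coeff (P m) i = 0) \<and> (m > 0 \<longrightarrow> coeff (P m) m = 1)"
proof (induction m rule: less_induct)
  case (less m)
  consider "m = 0" | "m = 1" | k where "m = Suc (Suc k)"
    by (metis One_nat_def old.nat.exhaust)
  then show ?case
  proof cases
    case 1
    then show ?thesis using P0 by simp
  next
    case 2
    then show ?thesis by (auto simp: P1 coeff_pCons split: nat.splits)
  next
    case 3
    then show ?thesis
      using less[of k] less[of "Suc k"] by (auto simp: rec coeff_pCons split: nat.splits)
  qed
qed

lemma cheb_T_coeff: "i > m \<Longrightarrow> coeff (cheb_T m) i = 0" "coeff (cheb_T m) m = (if m = 0 then 2 else 1)"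
  using monic_rec_coeff[of cheb_T 0 "\<lambda>_. 0" "\<lambda>_. 1" m] by (auto simp: coeff_pCons split: nat.splits)

lemma cheb_V_coeff: "i > m \<Longrightarrow> coeff (cheb_V m) i = 0" "coeff (cheb_V m) m = 1"
  using monic_rec_coeff[of cheb_V "-1" "\<lambda>_. 0" "\<lambda>_. 1" m] by (cases m; auto)+

lemma big_q_hermite_coeff:
  "i > m \<Longrightarrow> coeff (big_q_hermite p m) i = 0" "coeff (big_q_hermite p m) m = 1"
  using monic_rec_coeff[of "big_q_hermite p" "-1" "\<lambda>k. - (p ^ Suc k)" "\<lambda>k. 1 - p ^ Suc k" m]
  by (cases m; auto)+

lemma phi_coeff:
  "i > m \<Longrightarrow> coeff (phi p m) i = 0" "coeff (phi p m) m = (\<Prod>i<m. - (p ^ i))"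
proof -
  have "(\<forall>i>m. coeff (phi p m) i = 0) \<and> coeff (phi p m) m = (\<Prod>i<m. - (p ^ i))"
  proof (induction m)
    case (Suc m)
    then show ?case
      by (auto simp: phi_def phi_factor_def coeff_pCons mult.commute[of _ "[:_, _:]"]
          split: nat.splits)
  qed (simp add: phi_def)
  then show "i > m \<Longrightarrow> coeff (phi p m) i = 0" "coeff (phi p m) m = (\<Prod>i<m. - (p ^ i))"
    by auto
qed

lemma phi_Suc:
  "phi p (Suc s) = smult (1 + (p ^ s)\<^sup>2) (phi p s) - smult (p ^ s) (pCons 0 (phi p s))"
  by (simp add: phi_def phi_factor_def mult.commute[of _ "[:_, _:]"])

lemma act_phi_Suc:
  "act z (phi p (Suc s)) k = (1 + (p ^ s)\<^sup>2) * act z (phi p s) k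
     - p ^ s * (act z (phi p s) (k + 1) + act z (phi p s) (k - 1))"
  by (simp only: phi_Suc act_diff act_smult act_pCons_0)

text \<open>The input from theta functions: quasi-periodicity, symmetry and one zero of
  \<open>k -> theta(q^(k+1); q^3)\<close>.\<close>

locale pentagonal_moments =
  fixes q p :: complex and z :: "int \<Rightarrow> complex"
  assumes q_nz: "q \<noteq> 0"
    and p_def: "p = inverse q"
    and shift: "z (k + 3) = - z k * q powi (- (k + 1))"
    and reflect: "z (1 - k) = z k"
    and vanish: "z 2 = 0"
begin

lemma z_shift: "z k = - (q powi (k + 1)) * z (k + 3)"
  unfolding shift power_int_minus[of q "k + 1"] using q_nz by simp

text \<open>
  In terms of the functional \<open>L\<close>, shifting the summation index gives
  \<open>L(f(u)) = - q L(u\<^sup>3 f(qu))\<close>. Here \<open>f = u\<^bsup>j\<^esup> \<phi>\<^sub>s(u) (1 - p\<^bsup>s\<^esup>u) (1 - q/u)\<close>, for which \<open>f(qu)\<close> is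
  again divisible by \<open>\<phi>\<^sub>s\<close>.
\<close>
lemma phi_shift:
  defines "G \<equiv> \<lambda>s. act z (phi p s)"
  shows "(1 + q * p ^ s) * G s j - q * G s (j - 1) - p ^ s * G s (j + 1) =
    - (q powi (j + 1)) * ((1 + q * p ^ s) * G s (j + 3) - q * G s (j + 4) - p ^ s * G s (j + 2))"
proof (induction s arbitrary: j)
  case 0
  have "z j = - (q powi (j + 1)) * z (j + 3)" "q * z (j - 1) = - (q powi (j + 1)) * z (j + 2)"
    "z (j + 1) = - (q powi (j + 1)) * (q * z (j + 4))"
    using q_nz z_shift[of j] z_shift[of "j - 1"] z_shift[of "j + 1"]
    by (simp_all add: power_int_add power2_eq_square algebra_simps)
  then show ?case
    by (simp add: G_def phi_def algebra_simps)
next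
  case (Suc s)
  \<comment> \<open>\<open>c\<close> and, below, \<open>Y\<close> make all coefficients polynomial:
    \<open>p ^ s = q * c\<close>, and the three shift factors are \<open>Y\<close>,
    \<open>q * Y\<close>, \<open>q * (q * Y)\<close>.\<close>
  define c where "c = p ^ Suc s"
  define X where "X = q powi (j + 1)"
  have c: "p ^ s = q * c"
    using q_nz by (simp add: c_def p_def)
  have X: "q powi (j + 2) = q * X" "X = q * q powi j"
    using q_nz by (simp_all add: X_def power_int_add power2_eq_square)
  define Y where "Y = q powi j"
  have rec: "G (Suc s) k = (1 + (q * c)\<^sup>2) * G s k - q * c * (G s (k + 1) + G s (k - 1))" for k
    unfolding G_def act_phi_Suc c ..
  have e0: "(1 + q * (q * c)) * G s j - q * G s (j - 1) - (q * c) * G s (j + 1) =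
      - (q * Y) * ((1 + q * (q * c)) * G s (j + 3) - q * G s (j + 4) - (q * c) * G s (j + 2))"
    using Suc[of j] X unfolding c X_def[symmetric] Y_def[symmetric] by simp
  have e1: "(1 + q * (q * c)) * G s (j + 1) - q * G s j - (q * c) * G s (j + 2) =
      - (q * (q * Y)) * ((1 + q * (q * c)) * G s (j + 4) - q * G s (j + 5) - (q * c) * G s (j + 3))"
    using Suc[of "j + 1"] X unfolding c Y_def[symmetric] by (simp add: add.assoc)
  have e2: "(1 + q * (q * c)) * G s (j - 1) - q * G s (j - 2) - (q * c) * G s j =
      - Y * ((1 + q * (q * c)) * G s (j + 2) - q * G s (j + 3) - (q * c) * G s (j + 1))"
    using Suc[of "j - 1"] unfolding c Y_def by (simp add: add.commute)
  \<comment> \<open>The new factor of \<open>phi\<close> is \<open>(1 - q c u)(1 - q c/u)\<close>.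
    Regrouping leaves the induction hypothesis times
    \<open>(1 - c u)(1 - q c/u) = 1 + q c^2 - c u - q c/u\<close>, hence its instances at
    \<open>j\<close>, \<open>j + 1\<close>, \<open>j - 1\<close>.\<close>
  have "(1 + q * c) * G (Suc s) j - q * G (Suc s) (j - 1) - c * G (Suc s) (j + 1) =
      (1 + q * c * c) * ((1 + q * (q * c)) * G s j - q * G s (j - 1) - (q * c) * G s (j + 1))
      - c * ((1 + q * (q * c)) * G s (j + 1) - q * G s j - (q * c) * G s (j + 2))
      - q * c * ((1 + q * (q * c)) * G s (j - 1) - q * G s (j - 2) - (q * c) * G s j)"
    unfolding rec by (simp add: power2_eq_square algebra_simps)
  also have "\<dots> = - (q * Y) * ((1 + q * c) * G (Suc s) (j + 3) - q * G (Suc s) (j + 4) - c * G (Suc s) (j + 2))"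
    unfolding rec e0 e1 e2 by (simp add: power2_eq_square algebra_simps)
  finally show ?case
    using X unfolding c_def[symmetric] X_def[symmetric] Y_def[symmetric] by simp
qed

text \<open>Passing from \<open>s\<close> to \<open>s + 1\<close> involves neighbouring indices, so
  the values at 1 and 2 are carried together; \<open>phi_shift\<close> supplies the value at
  3.\<close>

lemma act_phi: "act z (phi p s) 0 = z 0"
proof -
  have refl: "act z F (1 - k) = act z F k" for F k
    by (rule act_reflect[where z = z, OF reflect])
  have "act z (phi p s) 1 = z 0 \<and> act z (phi p s) 2 = (p ^ s - 1) * z 0"
  proof (induction s)
    case 0
    show ?case
      using reflect[of 0] vanish by (simp add: phi_def)
  next
    case (Suc s)
    let ?G = "act z (phi p s)"
    have pq: "p * q = 1"
      using q_nz by (simp add: p_def)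
    have G: "?G 1 = z 0" "?G 2 = (p ^ s - 1) * z 0"
      using Suc by auto
    \<comment> \<open>At \<open>j = -1\<close> reflection identifies the two sides of
      \<open>phi_shift\<close> up to sign, so the expression equals its own negative.\<close>
    have "2 * ((1 + q * p ^ s) * ?G 2) = 2 * (q * ?G 3 + p ^ s * ?G 1)"
      using phi_shift[of s "-1"] refl[of "phi p s" 2] refl[of "phi p s" 3] refl[of "phi p s" 1]
      by (simp add: algebra_simps)
    then have "q * ?G 3 = (1 + q * p ^ s) * ?G 2 - p ^ s * ?G 1"
      unfolding mult_cancel_left by simp
    then have "p * (q * ?G 3) = p * ((1 + q * p ^ s) * ?G 2 - p ^ s * ?G 1)"
      by simp
    then have "?G 3 = p * ((1 + q * p ^ s) * ?G 2 - p ^ s * ?G 1)"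
      using pq by (simp add: mult.assoc[symmetric])
    also have "\<dots> = (p + p * q * p ^ s) * ?G 2 - p * p ^ s * ?G 1"
      by (simp add: algebra_simps)
    also note pq
    finally have G3: "?G 3 = ((p + p ^ s) * (p ^ s - 1) - p * p ^ s) * z 0"
      by (simp add: G algebra_simps)
    have G0: "?G 0 = z 0"
      using refl[of "phi p s" 1] G by simp
    show ?case
      by (simp add: act_phi_Suc G G0 G3 power2_eq_square algebra_simps)
  qed
  then show ?thesis
    using refl[of "phi p s" 0] by simp
qed

lemma p_nz: "p \<noteq> 0"
  using q_nz by (simp add: p_def)

text \<open>Uses \<open>y \<phi>\<^sub>j = (p\<^bsup>j\<^esup> + q\<^bsup>j\<^esup>) \<phi>\<^sub>j - q\<^bsup>j\<^esup> \<phi>\<^bsub>j+1\<^esub>\<close>.\<close>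
lemma act_phi_y:
  "act z (phi p j * pCons 0 F) 0 =
     (p ^ j + q ^ j) * act z (phi p j * F) 0 - q ^ j * act z (phi p (Suc j) * F) 0"
proof -
  have "p ^ j * q ^ j = 1"
    using q_nz by (simp add: p_def power_mult_distrib[symmetric])
  have "phi p (Suc j) * F = smult (1 + (p ^ j)\<^sup>2) (phi p j * F) - smult (p ^ j) (phi p j * pCons 0 F)"
    by (simp add: phi_Suc left_diff_distrib)
  then have *: "p ^ j * act z (phi p j * pCons 0 F) 0 =
      (1 + (p ^ j)\<^sup>2) * act z (phi p j * F) 0 - act z (phi p (Suc j) * F) 0"
    by (simp only: act_diff act_smult) simp
  have "(p ^ j * q ^ j) * act z (phi p j * pCons 0 F) 0 =
      q ^ j * (p ^ j * act z (phi p j * pCons 0 F) 0)"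
    by (simp only: mult_ac)
  also have "\<dots> = (p ^ j * (p ^ j * q ^ j) + q ^ j) * act z (phi p j * F) 0
      - q ^ j * act z (phi p (Suc j) * F) 0"
    unfolding * by (simp add: power2_eq_square algebra_simps)
  finally show ?thesis
    by (simp only: \<open>p ^ j * q ^ j = 1\<close> mult_1 mult_1_right)
qed

text \<open>The product vanishes for \<open>j < k\<close>, which is the orthogonality.
  Multiplication by \<open>y\<close> moves \<open>phi p j\<close> to \<open>phi p (Suc j)\<close>,
  so the induction on \<open>k\<close> runs over all \<open>j\<close>.\<close>

lemma act_phi_hermite:
  "act z (phi p j * big_q_hermite p k) 0 = z 0 * (\<Prod>i<k. p ^ j - p ^ i)"
proof -
  have pq: "p ^ j * q ^ j = 1" for j
    using q_nz by (simp add: p_def power_mult_distrib[symmetric])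
  \<comment> \<open>Read \<open>a = p ^ j\<close>, \<open>b = q ^ j\<close>,
    \<open>c = p ^ l\<close>; the only relation used is \<open>a * b = 1\<close>.\<close>
  have alg: "(a + b - p * c) * (w * (V * (a - c))) - b * (w * ((p * a - 1) * (c * V))) - (1 - p * c) * (w * V)
      = w * (V * (a - c) * (a - p * c))" if "a * b = 1" for a b c w V
  proof -
    have "(a + b - p * c) * (w * (V * (a - c))) - b * (w * ((p * a - 1) * (c * V))) - (1 - p * c) * (w * V)
      = w * (V * (a - c) * (a - p * c)) + (a * b - 1) * ((1 - p * c) * (w * V))"
      by (simp add: algebra_simps)
    then show ?thesis
      by (simp add: that)
  qed
  have "\<forall>j. act z (phi p j * big_q_hermite p k) 0 = z 0 * (\<Prod>i<k. p ^ j - p ^ i)"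
  proof (induction k rule: less_induct)
    case (less k)
    consider "k = 0" | "k = Suc 0" | l where "k = Suc (Suc l)"
      by (metis old.nat.exhaust)
    then show ?case
    proof cases
      case 1
      then show ?thesis by (simp add: act_phi)
    next
      case 2
      have "phi p j * [:-1, 1:] = phi p j * pCons 0 1 - phi p j" for j
        by (simp add: mult.commute[of _ "[:_, _:]"])
      then have "act z (phi p j * [:-1, 1:]) 0 = (p ^ j - 1) * z 0" for j
        using act_phi_y[of j 1] by (simp add: act_diff act_phi algebra_simps)
      then show ?thesis
        by (simp add: 2 mult.commute)
    next
      case 3
      show ?thesis
      proof
        fix j
        let ?P = "big_q_hermite p"
        define V where "V = (\<Prod>i<l. p ^ j - p ^ i)"
        have v0: "act z (phi p j * ?P l) 0 = z 0 * V"
          using less[of l] 3 by (simp add: V_def)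
        have v1: "act z (phi p j * ?P (Suc l)) 0 = z 0 * (V * (p ^ j - p ^ l))"
          using less[of "Suc l"] 3 by (simp add: V_def)
        have "act z (phi p (Suc j) * ?P (Suc l)) 0 = z 0 * (\<Prod>i<Suc l. p ^ Suc j - p ^ i)"
          using less[of "Suc l"] 3 by blast
        \<comment> \<open>Splitting off the factor \<open>i = 0\<close> and pulling \<open>p\<close>
          out of the others reduces \<open>j + 1\<close> to \<open>j\<close>.\<close>
        also have "(\<Prod>i<Suc l. p ^ Suc j - p ^ i) = (p ^ Suc j - 1) * (\<Prod>i<l. p * (p ^ j - p ^ i))"
          by (subst prod.lessThan_Suc_shift) (simp add: algebra_simps)
        also have "\<dots> = (p ^ Suc j - 1) * (p ^ l * V)"
          by (simp add: prod.distrib V_def)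
        finally have v2: "act z (phi p (Suc j) * ?P (Suc l)) 0 = z 0 * ((p * p ^ j - 1) * (p ^ l * V))"
          by simp
        have "phi p j * ?P k = phi p j * pCons 0 (?P (Suc l)) - smult (p ^ Suc l) (phi p j * ?P (Suc l))
            - smult (1 - p ^ Suc l) (phi p j * ?P l)"
          by (simp add: 3 right_diff_distrib distrib_left)
        then have "act z (phi p j * ?P k) 0 =
            (p ^ j + q ^ j - p * p ^ l) * (z 0 * (V * (p ^ j - p ^ l)))
            - q ^ j * (z 0 * ((p * p ^ j - 1) * (p ^ l * V))) - (1 - p * p ^ l) * (z 0 * V)"
          by (simp only: act_diff act_smult act_phi_y v0 v1 v2) (simp add: algebra_simps)
        also have "\<dots> = z 0 * (V * (p ^ j - p ^ l) * (p ^ j - p * p ^ l))"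
          by (rule alg[OF pq])
        finally show "act z (phi p j * ?P k) 0 = z 0 * (\<Prod>i<k. p ^ j - p ^ i)"
          by (simp add: 3 V_def)
      qed
    qed
  qed
  then show ?thesis by blast
qed

text \<open>The Gram matrix of \<open>phi\<close> against \<open>big_q_hermite\<close> is
  triangular. The top coefficients of \<open>phi\<close> appear both in its diagonal and in
  \<open>det_gram\<close>, and cancel.\<close>

lemma det_hankel:
  "det (mat n n (\<lambda>(i, j). moment z (i + j) 0)) = z 0 ^ n * (\<Prod>k<n. \<Prod>i<k. 1 - p ^ Suc i)"
proof -
  let ?M = "mat n n (\<lambda>(j, k). act z (phi p j * big_q_hermite p k) 0)"
  let ?c = "\<Prod>j<n. \<Prod>i<j. - (p ^ i)"
  have norm: "(\<Prod>i<k. p ^ k - p ^ i) = (\<Prod>i<k. - (p ^ i)) * (\<Prod>i<k. 1 - p ^ Suc i)" for k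
  proof -
    have "(\<Prod>i<k. p ^ k - p ^ i) = (\<Prod>i<k. - (p ^ i) * (1 - p ^ (k - i)))"
    proof (rule prod.cong)
      fix i assume "i \<in> {..<k}"
      then have "p ^ k = p ^ i * p ^ (k - i)"
        by (simp flip: power_add)
      then show "p ^ k - p ^ i = - (p ^ i) * (1 - p ^ (k - i))"
        by (simp add: algebra_simps)
    qed simp
    also have "\<dots> = (\<Prod>i<k. - (p ^ i)) * (\<Prod>i<k. 1 - p ^ (k - i))"
      by (rule prod.distrib)
    also have "(\<Prod>i<k. 1 - p ^ (k - i)) = (\<Prod>i<k. 1 - p ^ Suc (k - Suc i))"
      by (rule prod.cong) (auto simp: Suc_diff_Suc simp del: power_Suc)
    also have "\<dots> = (\<Prod>i<k. 1 - p ^ Suc i)"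
      by (rule prod.nat_diff_reindex)
    finally show ?thesis .
  qed
  have "det ?M = (\<Prod>k<n. z 0 * (\<Prod>i<k. p ^ k - p ^ i))"
    using det_lower_triangular[of n ?M]
    by (auto simp: act_phi_hermite prod_list_diag_prod atLeast0LessThan)
  also have "\<dots> = ?c * (z 0 ^ n * (\<Prod>k<n. \<Prod>i<k. 1 - p ^ Suc i))"
    unfolding norm by (simp add: prod.distrib mult_ac)
  finally have "det ?M = \<dots>" .
  moreover have "det ?M = ?c * det (mat n n (\<lambda>(i, j). moment z (i + j) 0))"
    by (subst det_gram) (auto simp: phi_coeff big_q_hermite_coeff)
  moreover have "?c \<noteq> 0"
    using p_nz by simp
  ultimately show ?thesis by simp
qed

text \<open>All Chebyshev polynomials involved are monic except \<open>cheb_T 0 = 2\<close>, the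
  source of the factor 2 and of \<open>n > 0\<close>.\<close>

lemma det_toeplitz_hankel:
  assumes "n > 0"
  shows "det (mat n n (\<lambda>(m, s). z (int s - int m) + z (- int s - int m))) =
    2 * z 0 ^ n * (\<Prod>k<n. \<Prod>i<k. 1 - p ^ Suc i)"
proof -
  have "act z (cheb_V m * cheb_T s) 0 = z (int s - int m) + z (- int s - int m)" for m s
  proof -
    have "- int m + int s = int s - int m" "- int m - int s = - int s - int m"
      by simp_all
    then show ?thesis
      by (simp only: act_cheb_V[where z = z, OF reflect] act_cheb_T)
  qed
  then have "mat n n (\<lambda>(m, s). z (int s - int m) + z (- int s - int m)) =
      mat n n (\<lambda>(m, s). act z (cheb_V m * cheb_T s) 0)"
    by (simp only:)
  also have "det \<dots> = det (mat n n (\<lambda>(i, j). moment z (i + j) 0)) * (\<Prod>s<n. if s = 0 then 2 else 1)"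
    by (subst det_gram) (auto simp: cheb_V_coeff cheb_T_coeff)
  also have "(\<Prod>s<n. if s = 0 then 2 else 1) = (2 :: complex)"
    using assms by (simp add: prod.delta)
  finally show ?thesis
    by (simp add: det_hankel)
qed

section \<open>Reduction of the theta entries by quasi-periodicity\<close>

lemma choose_2_int: "2 * int (m choose 2) = int m * (int m - 1)"
  by (induction m) (simp_all add: numeral_2_eq_2 algebra_simps)

lemma shift_iterate:
  "z (k + 3 * int m) = (-1) ^ m * q powi (- (int m * (k + 1)) - 3 * int (m choose 2)) * z k"
proof (induction m)
  case (Suc m)
  have "z (k + 3 * int (Suc m)) = - z (k + 3 * int m) * q powi (- (k + 3 * int m + 1))"
    using shift[of "k + 3 * int m"] by (simp add: algebra_simps)
  also have "\<dots> = (-1) ^ Suc m * (q powi (- (int m * (k + 1)) - 3 * int (m choose 2)) *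
      q powi (- (k + 3 * int m + 1))) * z k"
    by (simp add: Suc)
  also have "q powi (- (int m * (k + 1)) - 3 * int (m choose 2)) * q powi (- (k + 3 * int m + 1)) =
      q powi (- (int (Suc m) * (k + 1)) - 3 * int (Suc m choose 2))"
    using q_nz by (subst power_int_add[symmetric]) (simp_all add: numeral_2_eq_2 algebra_simps)
  finally show ?case .
qed (simp add: numeral_2_eq_2)

text \<open>Shifting \<open>m\<close> times by 3 cancels \<open>s\<close> from the power of
  \<open>q\<close>, so the prefactor depends on the row alone.\<close>

lemma entry:
  "q powi (int m * int s) * z (2 * int m + int s) + q powi (- (int m * int s)) * z (2 * int m - int s) =
    (-1) ^ m * q powi (- int (m choose 2)) * (z (int s - int m) + z (- int s - int m))"
proof -
  have *: "q powi (int m * t) * z (2 * int m + t) =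
      (-1) ^ m * q powi (- int (m choose 2)) * z (t - int m)" for t
  proof -
    have "int m * t + (- (int m * (t - int m + 1)) - 3 * int (m choose 2)) = - int (m choose 2)"
      using choose_2_int[of m] by (simp add: algebra_simps)
    then have "q powi (int m * t) * q powi (- (int m * (t - int m + 1)) - 3 * int (m choose 2)) =
        q powi (- int (m choose 2))"
      using q_nz by (subst power_int_add[symmetric]) (simp, simp only:)
    then show ?thesis
      using shift_iterate[of "t - int m" m] by (simp add: algebra_simps)
  qed
  show ?thesis
    using *[of "int s"] *[of "- int s"] by (simp add: algebra_simps)
qed

end

section \<open>Evaluation of the theta determinant\<close>

text \<open>The offset \<open>k + 1\<close> turns the symmetry \<open>x -> q^3/x\<close> into
  \<open>k -> 1 - k\<close>.\<close>

lemma pentagonal_moments_qtheta: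
  fixes q :: complex
  assumes "0 < norm q" "norm q < 1"
  shows "pentagonal_moments q (inverse q) (\<lambda>k. qtheta (q powi (k + 1)) (q ^ 3))"
proof
  have q: "q \<noteq> 0" "norm (q ^ 3) < 1"
    using assms by (auto simp: norm_power power_less_one_iff)
  show "q \<noteq> 0" "inverse q = inverse q"
    using q by auto
  fix k
  show "qtheta (q powi (k + 3 + 1)) (q ^ 3) = - qtheta (q powi (k + 1)) (q ^ 3) * q powi - (k + 1)"
    unfolding power_int_minus[of q "k + 1"]
    using qtheta_quasi_periodic[OF q(2), of "q powi (k + 1)"] q(1) power_int_add[of q "k + 1" 3]
    by (simp add: divide_inverse add_ac)
  show "qtheta (q powi (1 - k + 1)) (q ^ 3) = qtheta (q powi (k + 1)) (q ^ 3)"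
    using qtheta_symm[of "q ^ 3" "q powi (k + 1)"] q(1) power_int_diff[of q 3 "k + 1"]
    by simp
  show "qtheta (q powi (2 + 1)) (q ^ 3) = 0"
    using qtheta_self[OF q(2)] q(1) by simp
qed

section \<open>Rearranging products and collecting signs and powers of \<open>q\<close>\<close>

lemma prod_differences:
  fixes f :: "nat \<Rightarrow> 'a :: comm_monoid_mult"
  shows "(\<Prod>i\<in>{1..n}. \<Prod>j\<in>{i<..n}. f (j - i)) = (\<Prod>k<n. \<Prod>i<k. f (Suc i))"
proof (induction n)
  case (Suc n)
  have "(\<Prod>i\<in>{1..Suc n}. \<Prod>j\<in>{i<..Suc n}. f (j - i)) = (\<Prod>i\<in>{1..n}. \<Prod>j\<in>{i<..Suc n}. f (j - i))"
    by simp
  also have "\<dots> = (\<Prod>i\<in>{1..n}. f (Suc n - i) * (\<Prod>j\<in>{i<..n}. f (j - i)))"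
  proof (rule prod.cong)
    fix i assume "i \<in> {1..n}"
    then have "{i<..Suc n} = insert (Suc n) {i<..n}" by auto
    then show "(\<Prod>j\<in>{i<..Suc n}. f (j - i)) = f (Suc n - i) * (\<Prod>j\<in>{i<..n}. f (j - i))"
      by simp
  qed simp
  also have "\<dots> = (\<Prod>i\<in>{1..n}. f (Suc n - i)) * (\<Prod>k<n. \<Prod>i<k. f (Suc i))"
    by (simp only: prod.distrib Suc)
  also have "(\<Prod>i\<in>{1..n}. f (Suc n - i)) = (\<Prod>i<n. f (Suc i))"
    by (rule prod.reindex_bij_witness[of _ "\<lambda>i. n - i" "\<lambda>i. n - i"]) (auto simp: Suc_diff_le)
  finally show ?case
    by (simp add: mult.commute)
qed simp

lemma sum_squares_lessThan: "(\<Sum>k<n. k * k) = n * (n - 1) * (2 * n - 1) div (6 :: nat)"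
proof -
  have "6 * (\<Sum>k<n. k * k) = n * (n - 1) * (2 * n - 1)"
  proof (induction n)
    case (Suc n)
    then show ?case
      by (cases n) (simp_all add: algebra_simps)
  qed simp
  then show ?thesis by linarith
qed

text \<open>Each factor is \<open>1 - q^(-d) = - q^(-d) (1 - q^d)\<close>, and
  \<open>1 + ... + k\<close> is \<open>Suc k choose 2\<close>.\<close>

lemma prod_qpoch_inverse:
  fixes q :: complex
  assumes "q \<noteq> 0"
  shows "(\<Prod>i<k. 1 - inverse q ^ Suc i) =
    (-1) ^ k * q powi (- int (Suc k choose 2)) * (\<Prod>i<k. 1 - q ^ Suc i)"
proof (induction k)
  case (Suc k)
  have "q powi (- int (Suc (Suc k) choose 2)) = q powi (- int (Suc k choose 2)) * inverse q ^ Suc k"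
  proof -
    have "- int (Suc (Suc k) choose 2) = - int (Suc k choose 2) + - int (Suc k)"
      by (simp add: numeral_2_eq_2)
    moreover have "q powi (- int (Suc k choose 2) + - int (Suc k)) =
        q powi (- int (Suc k choose 2)) * q powi (- int (Suc k))"
      by (rule power_int_add) (use assms in simp)
    moreover have "q powi (- int (Suc k)) = inverse q ^ Suc k"
      by (simp only: power_int_minus power_int_of_nat power_inverse)
    ultimately show ?thesis
      by (simp only:)
  qed
  moreover have "1 - inverse q ^ Suc k = - (inverse q ^ Suc k * (1 - q ^ Suc k))"
    using assms by (simp add: field_simps)
  ultimately show ?case
    by (simp only: prod.lessThan_Suc Suc) (simp add: mult_ac del: power_Suc, simp)
qed (simp add: numeral_2_eq_2)

text \<open>The factors come from row reversal, \<open>entry\<close> and the Hankel determinant.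
  Index \<open>k\<close> contributes the sign \<open>(-1)^(3k)\<close> and the exponent
  \<open>-(k choose 2) - (Suc k choose 2) = -k^2\<close>.\<close>

lemma collect_powers:
  fixes q :: complex
  assumes "q \<noteq> 0"
  shows "(\<Prod>k<n. (-1) ^ k) * (\<Prod>k<n. (-1) ^ k * q powi (- int (k choose 2))) *
      (\<Prod>k<n. \<Prod>i<k. 1 - inverse q ^ Suc i) =
    (-1) ^ (n choose 2) * q powi (- int (\<Sum>k<n. k * k)) * (\<Prod>k<n. \<Prod>i<k. 1 - q ^ Suc i)"
proof (induction n)
  case (Suc n)
  have "- int (n choose 2) + - int (Suc n choose 2) = - int (n * n)"
    by (induction n) (simp_all add: numeral_2_eq_2 algebra_simps)
  then have e: "q powi (- int (n choose 2)) * q powi (- int (Suc n choose 2)) = q powi (- int (n * n))"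
    using assms by (subst power_int_add[symmetric]) simp_all
  have s: "(-1) ^ (Suc n choose 2) = (-1) ^ (n choose 2) * ((-1) ^ n :: complex)"
    by (simp add: numeral_2_eq_2 power_add)
  have sq: "(-1) ^ n * (-1) ^ n = (1 :: complex)"
    by (simp flip: power_mult_distrib)
  have S: "q powi (- int (\<Sum>k<Suc n. k * k)) = q powi (- int (\<Sum>k<n. k * k)) * q powi (- int (n * n))"
    using assms by (subst power_int_add[symmetric]) simp_all
  let ?a = "(\<Prod>k<n. (-1) ^ k) :: complex" and ?b = "\<Prod>k<n. (-1) ^ k * q powi (- int (k choose 2))"
    and ?c = "\<Prod>k<n. \<Prod>i<k. 1 - inverse q ^ Suc i" and ?d = "\<Prod>k<n. \<Prod>i<k. 1 - q ^ Suc i"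
    and ?e = "\<Prod>i<n. 1 - q ^ Suc i" and ?s = "(-1) ^ n :: complex"
  have "(\<Prod>k<Suc n. (-1) ^ k) * (\<Prod>k<Suc n. (-1) ^ k * q powi (- int (k choose 2))) *
      (\<Prod>k<Suc n. \<Prod>i<k. 1 - inverse q ^ Suc i) =
    (?a * ?s) * (?b * (?s * q powi (- int (n choose 2)))) *
      (?c * (?s * q powi (- int (Suc n choose 2)) * ?e))"
    unfolding prod.lessThan_Suc[of _ n] prod_qpoch_inverse[OF assms, of n] ..
  also have "\<dots> = (?a * ?b * ?c) * (?s * ?s) * ?s *
      (q powi (- int (n choose 2)) * q powi (- int (Suc n choose 2))) * ?e"
    by (simp only: mult_ac)
  also have "\<dots> = (-1) ^ (Suc n choose 2) * q powi (- int (\<Sum>k<Suc n. k * k)) *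
      (\<Prod>k<Suc n. \<Prod>i<k. 1 - q ^ Suc i)"
    unfolding Suc sq e s S prod.lessThan_Suc[of "\<lambda>k. \<Prod>i<k. 1 - q ^ Suc i" n] by (simp only: mult_ac mult_1)
  finally show ?case .
qed (simp add: numeral_2_eq_2)

theorem mainTheorem9:
  fixes n :: nat and q :: complex
  assumes "n \<ge> 1" and "0 < norm q" and "norm q < 1"
  shows "2 * (-1) ^ (n choose 2) * q powi (- int (n * (n - 1) * (2 * n - 1) div 6))
           * qtheta q (q ^ 3) ^ n
           * (\<Prod>i\<in>{1..n}. \<Prod>j\<in>{i<..n}. qpoch_inf (q ^ (j - i)) q / qpoch_inf (q ^ (j - i + 1)) q)
         = det (theta_matrix n q)"
proof -
  define z where "z = (\<lambda>k. qtheta (q powi (k + 1)) (q ^ 3))"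
  interpret pentagonal_moments q "inverse q" z
    unfolding z_def by (rule pentagonal_moments_qtheta[OF assms(2,3)])
  define c where "c = (\<lambda>m. (-1) ^ m * q powi (- int (m choose 2)))"
  define g where "g = (\<lambda>m s. z (int s - int m) + z (- int s - int m))"
  \<comment> \<open>The 0-based row \<open>r\<close> has \<open>i = r + 1\<close>, so
    \<open>m = n - i = n - 1 - r\<close>.\<close>
  have "theta_matrix n q = mat n n (\<lambda>(r, s). (\<lambda>m s. c m * g m s) (n - 1 - r) s)"
  proof (rule eq_matI)
    fix r s
    assume "r < dim_row (mat n n (\<lambda>(r, s). (\<lambda>m s. c m * g m s) (n - 1 - r) s))"
      "s < dim_col (mat n n (\<lambda>(r, s). (\<lambda>m s. c m * g m s) (n - 1 - r) s))"
    then have rs: "r < n" "s < n" by auto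
    define m where "m = n - 1 - r"
    have m: "int n = int m + int r + 1" "n - Suc r = m"
      using rs by (simp_all add: m_def)
    show "theta_matrix n q $$ (r, s) = mat n n (\<lambda>(r, s). (\<lambda>m s. c m * g m s) (n - 1 - r) s) $$ (r, s)"
      using entry[of m s] rs
      by (simp add: theta_matrix_def Let_def m c_def g_def z_def algebra_simps)
  qed (auto simp: theta_matrix_def)
  then have "det (theta_matrix n q) = (\<Prod>k<n. (-1) ^ k) * det (mat n n (\<lambda>(m, s). c m * g m s))"
    using det_rev_rows[of n "\<lambda>m s. c m * g m s"] by simp
  also have "\<dots> = (\<Prod>k<n. (-1) ^ k) * ((\<Prod>k<n. c k) *
      (2 * z 0 ^ n * (\<Prod>k<n. \<Prod>i<k. 1 - inverse q ^ Suc i)))"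
    using det_toeplitz_hankel[of n] assms(1) by (simp add: det_scale_rows g_def)
  also have "\<dots> = 2 * z 0 ^ n * ((\<Prod>k<n. (-1) ^ k) * (\<Prod>k<n. (-1) ^ k * q powi (- int (k choose 2))) *
      (\<Prod>k<n. \<Prod>i<k. 1 - inverse q ^ Suc i))"
    unfolding c_def by (simp only: mult_ac)
  also have "\<dots> = 2 * z 0 ^ n * ((-1) ^ (n choose 2) *
      q powi (- int (n * (n - 1) * (2 * n - 1) div 6)) * (\<Prod>k<n. \<Prod>i<k. 1 - q ^ Suc i))"
    unfolding collect_powers[OF q_nz] sum_squares_lessThan ..
  also have "(\<Prod>k<n. \<Prod>i<k. 1 - q ^ Suc i) = (\<Prod>i\<in>{1..n}. \<Prod>j\<in>{i<..n}. 1 - q ^ (j - i))"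
    by (rule prod_differences[symmetric])
  \<comment> \<open>Each quotient of infinite products telescopes to its first factor.\<close>
  also have "\<dots> = (\<Prod>i\<in>{1..n}. \<Prod>j\<in>{i<..n}.
      qpoch_inf (q ^ (j - i)) q / qpoch_inf (q ^ (j - i + 1)) q)"
  proof (intro prod.cong refl)
    fix i j assume "i \<in> {1..n}" "j \<in> {i<..n}"
    then have "norm (q ^ (j - i)) < 1"
      using assms by (auto simp: norm_power power_less_one_iff)
    then show "1 - q ^ (j - i) = qpoch_inf (q ^ (j - i)) q / qpoch_inf (q ^ (j - i + 1)) q"
      using qpoch_inf_ratio[OF assms(3), of "q ^ (j - i)"] by (simp add: mult.commute)
  qed
  also have "z 0 = qtheta q (q ^ 3)"
    by (simp add: z_def)
  finally show ?thesis
    by (simp only: mult_ac)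
qed

end
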